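(* Let $q\in(0,1)$, $\nu\in[0,1)$, $R,L\geq0$ with $R+L=1$. Define $H:\mathbb{X}^\infty\times\mathbb{Y}^\infty\to\mathbb{R}$ by $$H(\vec x,\vec y)=\prod_{i=0}^\infty q^{(x_i+i)y_i},$$ with the convention that the product is $0$ when $y_0>0$. Then for any $(\vec x,\vec y)\in\mathbb{X}^\infty\times\mathbb{Y}^\infty$, $$B_{q,\nu}H(\vec x,\vec y)=T_{q,\nu}H(\vec x,\vec y),$$ where $B_{q,\nu}$ acts on the $\vec y$ variable and $T_{q,\nu}$ acts on the $\vec x$ variable.
   Context: Notation: $(a;q)_n=\prod_{i=0}^{n-1}(1-aq^i)$ and $[j]_q=\frac{1-q^j}{1-q}$. For integers $1\le j\le m$ set $$\phi^R_{q,\nu}(j|m)=R\,\frac{\nu^{j-1}}{[j]_q}\frac{(\nu;q)_{m-j}}{(\nu;q)_m}\frac{(q;q)_m}{(q;q)_{m-j}},\qquad \phi^L_{q,\nu}(j|m)=L\,\frac{1}{[j]_q}\frac{(\nu;q)_{m-j}}{(\nu;q)_m}\frac{(q;q)_m}{(q;q)_{m-j}},$$ with $\nu^0=1$ also for $\nu=0$, and $\phi^R_{q,\nu}(j|\infty)=\lim_{m\to\infty}\phi^R_{q,\nu}(j|m)=R\nu^{j-1}/[j]_q$. State spaces: $\mathbb{Y}^\infty=\{(y_0,y_1,\dots): y_i\in\mathbb{Z}_{\ge0},\ \sum_i y_i<\infty\}$, and $\mathbb{X}^\infty$ is the set of sequences $+\infty=x_0>x_1>x_2>\cdots$ with $x_n\in\mathbb{Z}$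 for $n\ge1$ such that for some $N$, $x_n-x_{n+1}=1$ for all $n\ge N$. For $\vec y\in\mathbb{Y}^\infty$, $\vec y^{\,j}_{i,i-1}$ (resp. $\vec y^{\,j}_{i,i+1}$) is obtained by replacing $y_i$ by $y_i-j$ and $y_{i-1}$ by $y_{i-1}+j$ (resp. $y_{i+1}$ by $y_{i+1}+j$). For $\vec x$, $\vec x_i^{\,j}$ is obtained by replacing $x_i$ by $x_i+j$. The generator of the $q$-Hahn AZRP acts on functions $f$ on $\mathbb{Y}^\infty$ by $$(B_{q,\nu}f)(\vec y)=\sum_{i=1}^\infty\left(\sum_{j=1}^{y_i}\phi^R_{q,\nu}(j|y_i)\big(f(\vec y^{\,j}_{i,i-1})-f(\vec y)\big)+\sum_{j=1}^{y_i}\phi^L_{q,\nu}(j|y_i)\big(f(\vec y^{\,j}_{i,i+1})-f(\vec y)\big)\right).$$ The generator of the $q$-Hahn AEP acts on functions $f$ on $\mathbb{X}^\infty$ by $$(T_{q,\nu}f)(\vec x)=\sum_{i=1}^\infty\left(\sum_{j=1}^{x_{i-1}-x_i-1}\phi^R_{q,\nu}(j|x_{i-1}-x_i-1)\big(f(\vec x_i^{\,+j})-f(\vec x)\big)+\sum_{j=1}^{x_i-x_{i+1}-1}\phi^L_{q,\nu}(j|x_i-x_{i+1}-1)\big(f(\vec x_i^{\,-j})-f(\vec x)\big)\right),$$ where for $i=1$ the first inner sum runs over all $j\ge1$ with rates $\phi^R_{q,\nu}(j|\infty)$. *)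

theory Defs
  imports "HOL-Analysis.Analysis" "HOL-Library.Extended"
begin

definition qpoch :: "real \<Rightarrow> real \<Rightarrow> nat \<Rightarrow> real" where
  "qpoch a q n = (\<Prod>i<n. 1 - a * q ^ i)"

definition qnum :: "real \<Rightarrow> nat \<Rightarrow> real" where
  "qnum q j = (1 - q ^ j) / (1 - q)"

text \<open>The rates are meant for \<open>1 \<le> j \<le> m\<close>.\<close>

definition phiR :: "real \<Rightarrow> real \<Rightarrow> real \<Rightarrow> nat \<Rightarrow> nat \<Rightarrow> real" where
  "phiR q \<nu> R j m =
     R * (\<nu> ^ (j - 1) / qnum q j) * (qpoch \<nu> q (m - j) / qpoch \<nu> q m)
       * (qpoch q q m / qpoch q q (m - j))"

definition phiL :: "real \<Rightarrow> real \<Rightarrow> real \<Rightarrow> nat \<Rightarrow> nat \<Rightarrow> real" where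
  "phiL q \<nu> L j m =
     L * (1 / qnum q j) * (qpoch \<nu> q (m - j) / qpoch \<nu> q m)
       * (qpoch q q m / qpoch q q (m - j))"

definition phiR_inf :: "real \<Rightarrow> real \<Rightarrow> real \<Rightarrow> nat \<Rightarrow> real" where
  "phiR_inf q \<nu> R j = lim (\<lambda>m. phiR q \<nu> R j m)"

lemma qpoch_nonzero:
  assumes "0 < q" "q < 1" "0 \<le> a" "a < 1"
  shows "qpoch a q n \<noteq> 0"
proof -
  have "a * q ^ i < 1" for i
    using assms mult_left_le[of "q ^ i" a] power_le_one[of q i] by simp
  then show ?thesis
    unfolding qpoch_def by (auto simp: prod_zero_iff dest: less_imp_neq)
qed

lemma qpoch_ratio_tendsto:
  assumes "0 < q" "q < 1" "0 \<le> a" "a < 1"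
  shows "(\<lambda>m. qpoch a q m / qpoch a q (m - j)) \<longlonglongrightarrow> 1"
proof (rule LIMSEQ_offset[where k = j])
  have "qpoch a q (n + j) = qpoch a q n * (\<Prod>i<j. 1 - a * (q ^ n * q ^ i))" for n
    unfolding qpoch_def
    by (induction j) (simp_all add: power_add mult.assoc)
  then have eq: "qpoch a q (n + j) / qpoch a q (n + j - j) = (\<Prod>i<j. 1 - a * (q ^ n * q ^ i))" for n
    using qpoch_nonzero[OF assms, of n] by simp
  have "(\<lambda>n. q ^ n) \<longlonglongrightarrow> 0"
    using assms by (intro LIMSEQ_power_zero) simp
  then have "(\<lambda>n. \<Prod>i<j. 1 - a * (q ^ n * q ^ i)) \<longlonglongrightarrow> (\<Prod>i<j. 1 - a * (0 * q ^ i))"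
    by (intro tendsto_prod tendsto_diff tendsto_mult tendsto_const)
  then show "(\<lambda>n. qpoch a q (n + j) / qpoch a q (n + j - j)) \<longlonglongrightarrow> 1"
    unfolding eq by simp
qed

lemma phiR_inf_eq:
  assumes "0 < q" "q < 1" "0 \<le> \<nu>" "\<nu> < 1"
  shows "(\<lambda>m. phiR q \<nu> R j m) \<longlonglongrightarrow> R * \<nu> ^ (j - 1) / qnum q j"
    and "phiR_inf q \<nu> R j = R * \<nu> ^ (j - 1) / qnum q j"
proof -
  have "(\<lambda>m. R * (\<nu> ^ (j - 1) / qnum q j) * inverse (qpoch \<nu> q m / qpoch \<nu> q (m - j))
          * (qpoch q q m / qpoch q q (m - j)))
        \<longlonglongrightarrow> R * (\<nu> ^ (j - 1) / qnum q j) * inverse 1 * 1"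
    using assms by (intro tendsto_intros qpoch_ratio_tendsto) auto
  then show lim: "(\<lambda>m. phiR q \<nu> R j m) \<longlonglongrightarrow> R * \<nu> ^ (j - 1) / qnum q j"
    by (simp add: phiR_def)
  then show "phiR_inf q \<nu> R j = R * \<nu> ^ (j - 1) / qnum q j"
    unfolding phiR_inf_def by (rule limI)
qed

definition Y_infty :: "(nat \<Rightarrow> nat) set" where
  "Y_infty = {y. summable (\<lambda>i. real (y i))}"

lemma Y_infty_finite_support: "Y_infty = {y. finite {i. y i \<noteq> 0}}"
proof (intro set_eqI iffI)
  fix y :: "nat \<Rightarrow> nat"
  assume "y \<in> Y_infty"
  then have "(\<lambda>i. real (y i)) \<longlonglongrightarrow> 0"
    by (auto simp: Y_infty_def intro: summable_LIMSEQ_zero)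
  then have "eventually (\<lambda>i. real (y i) < 1) sequentially"
    by (rule order_tendstoD) simp
  then obtain N where "\<And>i. i \<ge> N \<Longrightarrow> y i = 0"
    by (auto simp: eventually_sequentially)
  then have "{i. y i \<noteq> 0} \<subseteq> {..<N}"
    by (force simp: not_le)
  then show "y \<in> {y. finite {i. y i \<noteq> 0}}"
    using finite_subset by auto
next
  fix y :: "nat \<Rightarrow> nat"
  assume "y \<in> {y. finite {i. y i \<noteq> 0}}"
  then show "y \<in> Y_infty"
    by (auto simp: Y_infty_def intro: summable_finite[of "{i. y i \<noteq> 0}"])
qed

text \<open>Integer sequences with \<open>x 0 = +\<infinity>\<close>; \<open>Fin\<close> embeds the integers into
  the extended integers.\<close>

definition X_infty :: "(nat \<Rightarrow> int extended) set" where
  "X_infty = {x. x 0 = Pinf \<and> (\<forall>n\<ge>1. x n \<in> range Fin) \<and> (\<forall>n. x n > x (Suc n)) \<and>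
                 (\<exists>N. \<forall>n\<ge>N. x n - x (Suc n) = 1)}"

definition move :: "(nat \<Rightarrow> nat) \<Rightarrow> nat \<Rightarrow> nat \<Rightarrow> nat \<Rightarrow> (nat \<Rightarrow> nat)" where
  "move y i k j = y(i := y i - j, k := y k + j)"

definition shift :: "(nat \<Rightarrow> int extended) \<Rightarrow> nat \<Rightarrow> int \<Rightarrow> (nat \<Rightarrow> int extended)" where
  "shift x i j = x(i := x i + Fin j)"

text \<open>\<open>gap x i\<close> is \<open>x\<^sub>i\<^sub>-\<^sub>1 - x\<^sub>i - 1\<close>; it is used only for \<open>i \<ge> 2\<close>, where this number is
  a nonnegative integer. The remaining case is a dummy value.\<close>

definition gap :: "(nat \<Rightarrow> int extended) \<Rightarrow> nat \<Rightarrow> nat" where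
  "gap x i = (case x (i - 1) - x i - 1 of Fin k \<Rightarrow> nat k | _ \<Rightarrow> 0)"

text \<open>On the state spaces only finitely many terms of the sums over \<open>i\<close> are nonzero.\<close>

definition AZRP_gen ::
  "real \<Rightarrow> real \<Rightarrow> real \<Rightarrow> real \<Rightarrow> ((nat \<Rightarrow> nat) \<Rightarrow> real) \<Rightarrow> (nat \<Rightarrow> nat) \<Rightarrow> real" where
  "AZRP_gen q \<nu> R L f y =
     (\<Sum>\<^sub>\<infinity>i\<in>{1..}.
        (\<Sum>j=1..y i. phiR q \<nu> R j (y i) * (f (move y i (i - 1) j) - f y))
      + (\<Sum>j=1..y i. phiL q \<nu> L j (y i) * (f (move y i (i + 1) j) - f y)))"

definition AEP_gen ::
  "real \<Rightarrow> real \<Rightarrow> real \<Rightarrow> real \<Rightarrow> ((nat \<Rightarrow> int extended) \<Rightarrow> real) \<Rightarrow> (nat \<Rightarrow> int extended) \<Rightarrow> real"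
  where
  "AEP_gen q \<nu> R L f x =
     (\<Sum>\<^sub>\<infinity>i\<in>{1..}.
        (if i = 1
         then \<Sum>\<^sub>\<infinity>j\<in>{1..}. phiR_inf q \<nu> R j * (f (shift x i (int j)) - f x)
         else \<Sum>j=1..gap x i. phiR q \<nu> R j (gap x i) * (f (shift x i (int j)) - f x))
      + (\<Sum>j=1..gap x (i + 1).
           phiL q \<nu> L j (gap x (i + 1)) * (f (shift x i (- int j)) - f x)))"

text \<open>\<open>q\<^bsup>e n\<^esup>\<close> for an extended integer \<open>e\<close> and \<open>0 < q < 1\<close>, with \<open>q\<^bsup>+\<infinity>\<^esup> = 0\<close> and
  \<open>+\<infinity> \<cdot> 0 = 0\<close> (the value at \<open>Minf\<close> is a dummy). The factor with index \<open>0\<close> in \<open>H\<close> is thus \<open>0\<close>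
  or \<open>1\<close> according to whether \<open>y 0 > 0\<close> or not; see \<open>H_zero\<close> below.\<close>

definition qpow :: "real \<Rightarrow> int extended \<Rightarrow> nat \<Rightarrow> real" where
  "qpow q e n =
     (case e of Fin k \<Rightarrow> q powi (k * int n) | Pinf \<Rightarrow> (if n = 0 then 1 else 0) | Minf \<Rightarrow> 0)"

definition H :: "real \<Rightarrow> (nat \<Rightarrow> int extended) \<Rightarrow> (nat \<Rightarrow> nat) \<Rightarrow> real" where
  "H q x y = (\<Prod>i. qpow q (x i + Fin (int i)) (y i))"

lemma H_eq_prod:
  assumes "x \<in> X_infty" "y \<in> Y_infty"
  shows "H q x y = (\<Prod>i | y i \<noteq> 0. qpow q (x i + Fin (int i)) (y i))"
  unfolding H_def
proof (rule prodinf_finite)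
  show "finite {i. y i \<noteq> 0}"
    using assms by (simp add: Y_infty_finite_support)
  show "qpow q (x i + Fin (int i)) (y i) = 1" if "i \<notin> {i. y i \<noteq> 0}" for i
  proof (cases "i = 0")
    case True
    then show ?thesis using that assms by (simp add: X_infty_def qpow_def)
  next
    case False
    then have "x i \<in> range Fin" using assms by (simp add: X_infty_def)
    then show ?thesis using that by (auto simp: qpow_def)
  qed
qed

lemma H_zero:
  assumes "x \<in> X_infty" "y \<in> Y_infty" "y 0 > 0"
  shows "H q x y = 0"
  using assms
  by (auto simp: H_eq_prod Y_infty_finite_support X_infty_def qpow_def intro!: prod_zero bexI[of _ 0])

end

theory Submission
  imports Defs
begin

text \<open>
  Write \<open>g\<^sub>i = x\<^sub>i\<^sub>-\<^sub>1 - x\<^sub>i - 1\<close> for the gaps. A jump of \<open>j\<close> particles to the left out of site \<open>i\<close>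
  multiplies \<open>H\<close> by \<open>q\<close> to the power \<open>j g\<^sub>i\<close>, and a jump of \<open>x\<^sub>i\<close> by \<open>j\<close> to the right
  multiplies it by \<open>q\<close> to the power \<open>j y\<^sub>i\<close>; the other direction gives the powers \<open>-j g\<^sub>i\<^sub>+\<^sub>1\<close> and
  \<open>-j y\<^sub>i\<close>. The two generators therefore agree term by term as soon as the sums
  \<open>F(m, n) = \<Sum>\<^sub>1\<^sub>\<le>\<^sub>j\<^sub>\<le>\<^sub>m \<phi>(j|m) (q\<^sup>\<plusminus>\<^sup>n\<^sup>j - 1)\<close> are symmetric in \<open>m\<close> and \<open>n\<close>.

  Both symmetries are instances of one rational identity in parameters \<open>p, a, b\<close>: the right jumps
  are \<open>(q, 1, \<nu>)\<close> and the left jumps are \<open>(1/q, \<nu>, 1)\<close>. The difference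
  \<open>D(m, n) = F(m, n + 1) - F(m, n)\<close>, suitably normalised, satisfies a first order recurrence in each variable, these
  give the symmetry of \<open>(a - b p\<^sup>n) D(m, n) + p\<^sup>m\<close>, and with it that of
  \<open>D(m + 1, n) - D(m, n)\<close>, the mixed second difference of \<open>F\<close>. The infinite gap in front of the
  first particle is the limit \<open>n \<rightarrow> \<infinity>\<close>.
\<close>

section \<open>Symmetric sums in the parameters \<open>p\<close>, \<open>a\<close>,
  \<open>b\<close>\<close>

text \<open>For \<open>(p, a, b) = (q, 1, \<nu>)\<close> this is the q-Pochhammer factor common to
  both rates. The parameter \<open>a\<close> lets the same formula serve the left jumps, where
  \<open>p = 1 / q\<close>.\<close>

definition ratio_prod :: "real \<Rightarrow> real \<Rightarrow> real \<Rightarrow> nat \<Rightarrow> nat \<Rightarrow> real" where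
  "ratio_prod p a b m j = (\<Prod>i=m-j..<m. (1 - p ^ Suc i) / (a - b * p ^ i))"

text \<open>The increment of \<open>dual_sum\<close> from \<open>n\<close> to \<open>n + 1\<close>,
  in which the denominators \<open>1 - p ^ j\<close> cancel.\<close>

definition ratio_sum :: "real \<Rightarrow> real \<Rightarrow> real \<Rightarrow> nat \<Rightarrow> nat \<Rightarrow> real" where
  "ratio_sum p a b m n = (\<Sum>j=1..m. b ^ (j - 1) * p ^ (n * j) * ratio_prod p a b m j)"

text \<open>The function F of the overview, up to a factor free of \<open>m\<close> and
  \<open>n\<close>.\<close>

definition dual_sum :: "real \<Rightarrow> real \<Rightarrow> real \<Rightarrow> nat \<Rightarrow> nat \<Rightarrow> real" where
  "dual_sum p a b m n =
     (\<Sum>j=1..m. b ^ (j - 1) * ((1 - p ^ (n * j)) / (1 - p ^ j)) * ratio_prod p a b m j)"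

lemma ratio_prod_0 [simp]: "ratio_prod p a b m 0 = 1"
  by (simp add: ratio_prod_def)

lemma ratio_prod_Suc_Suc:
  "ratio_prod p a b (Suc m) (Suc j) =
    (1 - p ^ Suc m) / (a - b * p ^ m) * ratio_prod p a b m j"
  unfolding ratio_prod_def by (subst prod.atLeastLessThan_Suc) (simp_all add: mult.commute)

lemma ratio_sum_0 [simp]: "ratio_sum p a b 0 n = 0"
  by (simp add: ratio_sum_def)

text \<open>Every product with \<open>j \<ge> 1\<close> contains the factor with index
  \<open>m\<close>. Pulling it out lowers both \<open>m\<close> and \<open>j\<close>; the summand
  that arrives at \<open>j = 0\<close> is the 1.\<close>

lemma ratio_sum_Suc:
  "ratio_sum p a b (Suc m) n =
     (1 - p ^ Suc m) / (a - b * p ^ m) * p ^ n * (1 + b * ratio_sum p a b m n)"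
proof -
  let ?c = "(1 - p ^ Suc m) / (a - b * p ^ m)"
  have "ratio_sum p a b (Suc m) n =
      (\<Sum>j=0..m. b ^ j * p ^ (n * Suc j) * ratio_prod p a b (Suc m) (Suc j))"
    unfolding ratio_sum_def One_nat_def sum.shift_bounds_cl_Suc_ivl by simp
  also have "\<dots> = (\<Sum>j=0..m. ?c * p ^ n * (b ^ j * p ^ (n * j) * ratio_prod p a b m j))"
    by (intro sum.cong) (simp_all add: ratio_prod_Suc_Suc power_add)
  also have "\<dots> = ?c * p ^ n * (\<Sum>j=0..m. b ^ j * p ^ (n * j) * ratio_prod p a b m j)"
    by (simp add: sum_distrib_left)
  also have "(\<Sum>j=0..m. b ^ j * p ^ (n * j) * ratio_prod p a b m j) =
      1 + (\<Sum>j=1..m. b * (b ^ (j - 1) * p ^ (n * j) * ratio_prod p a b m j))"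
    by (subst sum.atLeast_Suc_atMost)
       (auto simp: power_eq_if intro!: sum.cong)
  also have "(\<Sum>j=1..m. b * (b ^ (j - 1) * p ^ (n * j) * ratio_prod p a b m j)) =
      b * ratio_sum p a b m n"
    by (simp add: ratio_sum_def sum_distrib_left)
  finally show ?thesis .
qed

lemma ratio_sum_Suc_mult:
  assumes "a - b * p ^ m \<noteq> 0"
  shows "(a - b * p ^ m) * ratio_sum p a b (Suc m) n =
     (1 - p * p ^ m) * p ^ n * (1 + b * ratio_sum p a b m n)"
  using assms by (simp add: ratio_sum_Suc)

lemma ratio_sum_Suc_right:
  assumes nz: "\<And>i. a - b * p ^ i \<noteq> 0"
  shows "(a - b * (p * p ^ n)) * ratio_sum p a b m (Suc n) =
    p * p ^ n * (1 - p ^ m) + b * p ^ m * (1 - p * p ^ n) * ratio_sum p a b m n"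
proof (induction m)
  case 0
  then show ?case by simp
next
  case (Suc m)
  define A B D D' D1 D1' where defs: "A = p ^ m" "B = p ^ n"
    "D = ratio_sum p a b m n" "D' = ratio_sum p a b m (Suc n)"
    "D1 = ratio_sum p a b (Suc m) n" "D1' = ratio_sum p a b (Suc m) (Suc n)"
  have IH: "(a - b * (p * B)) * D' = p * B * (1 - A) + b * A * (1 - p * B) * D"
    using Suc by (simp add: defs)
  have 1: "(a - b * A) * D1 = (1 - p * A) * B * (1 + b * D)"
    using ratio_sum_Suc_mult[OF nz, of m n] by (simp only: defs)
  have 2: "(a - b * A) * D1' = (1 - p * A) * (p * B) * (1 + b * D')"
    using ratio_sum_Suc_mult[OF nz, of m "Suc n"] by (simp only: defs power_Suc)
  \<comment> \<open>The factor \<open>a - b * A\<close> lets the recurrence in \<open>m\<close>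
    replace \<open>D1'\<close> by \<open>D'\<close> and, after the induction hypothesis,
    \<open>D\<close> by \<open>D1\<close>. It is cancelled at the end.\<close>
  have "(a - b * A) * ((a - b * (p * B)) * D1') =
      (1 - p * A) * (p * B) * ((a - b * (p * B)) + b * ((a - b * (p * B)) * D'))"
    using 2 by algebra
  also have "\<dots> = (a - b * A) * (p * B * (1 - p * A))
      + b * (p * A) * (1 - p * B) * ((a - b * A) * D1)"
    unfolding IH 1 by algebra
  finally have "(a - b * A) * ((a - b * (p * B)) * D1') =
      (a - b * A) * (p * B * (1 - p * A) + b * (p * A) * (1 - p * B) * D1)"
    by algebra
  then show ?case
    using nz[of m] by (simp add: defs)
qed

text \<open>Multiplied by \<open>b\<close>, this says that
  \<open>(a - b * p ^ n) * (1 + b * ratio_sum p a b m n)\<close> is symmetric. The form chosen here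
  keeps its content for \<open>b = 0\<close>, which occurs for right jumps with
  \<open>\<nu> = 0\<close>.\<close>

lemma ratio_sum_swap:
  assumes nz: "\<And>i. a - b * p ^ i \<noteq> 0"
  shows "(a - b * p ^ n) * ratio_sum p a b m n + p ^ m =
    (a - b * p ^ m) * ratio_sum p a b n m + p ^ n"
proof (induction n)
  case 0
  \<comment> \<open>The right side is 1 here, since \<open>ratio_sum p a b 0 m\<close> is an empty
    sum.\<close>
  show ?case
  proof (induction m)
    case (Suc m)
    define A D where defs: "A = p ^ m" "D = ratio_sum p a b m 0"
    define D1 where "D1 = ratio_sum p a b (Suc m) 0"
    have IH: "(a - b) * D + A = 1"
      using Suc by (simp add: defs)
    have 1: "(a - b * A) * D1 = (1 - p * A) * (1 + b * D)"
      using ratio_sum_Suc_mult[OF nz, of m 0] by (simp add: defs D1_def)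
    have "(a - b * A) * ((a - b) * D1) = (a - b * A) * (1 - p * A)"
      using IH 1 by algebra
    then have "(a - b) * D1 = 1 - p * A"
      using nz[of m] by (simp add: defs)
    then show ?case by (simp add: defs D1_def)
  qed simp
next
  case (Suc n)
  define A B where defs: "A = p ^ m" "B = p ^ n"
  define D where "D = ratio_sum p a b m n"
  define D' where "D' = ratio_sum p a b m (Suc n)"
  define E where "E = ratio_sum p a b n m"
  define E1 where "E1 = ratio_sum p a b (Suc n) m"
  note defs = defs D_def D'_def E_def E1_def
  have IH: "(a - b * B) * D + A = (a - b * A) * E + B"
    using Suc by (simp add: defs)
  have 1: "(a - b * B) * E1 = (1 - p * B) * A * (1 + b * E)"
    using ratio_sum_Suc_mult[OF nz, of n m] by (simp only: defs)
  have 2: "(a - b * (p * B)) * D' = p * B * (1 - A) + b * A * (1 - p * B) * D"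
    using ratio_sum_Suc_right[OF nz, of n m] by (simp only: defs)
  have "(a - b * B) * ((a - b * A) * E1) = (1 - p * B) * A * (a - b * A + b * ((a - b * A) * E))"
    using 1 by algebra
  \<comment> \<open>\<open>b\<close> times the induction hypothesis turns
    \<open>(a - b * A) * (1 + b * E)\<close> into \<open>(a - b * B) * (1 + b * D)\<close>, which
    exhibits the factor to cancel.\<close>
  also have "\<dots> = (a - b * B) * ((1 - p * B) * A * (1 + b * D))"
    using IH by algebra
  finally have "(a - b * A) * E1 = (1 - p * B) * A * (1 + b * D)"
    using nz[of n] by (simp add: defs)
  then have "(a - b * (p * B)) * D' + A = (a - b * A) * E1 + p * B"
    using 2 by algebra
  then show ?case by (simp add: defs)
qed

text \<open>The recurrence in the first argument removes \<open>Suc m\<close> and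
  \<open>Suc n\<close>; what remains are the two sums related by
  \<open>ratio_sum_swap\<close>.\<close>

lemma ratio_sum_diff_swap:
  assumes nz: "\<And>i. a - b * p ^ i \<noteq> 0"
  shows "ratio_sum p a b (Suc m) n - ratio_sum p a b m n =
    ratio_sum p a b (Suc n) m - ratio_sum p a b n m"
proof -
  define A B where defs: "A = p ^ m" "B = p ^ n"
  define D where "D = ratio_sum p a b m n"
  define D1 where "D1 = ratio_sum p a b (Suc m) n"
  define E where "E = ratio_sum p a b n m"
  define E1 where "E1 = ratio_sum p a b (Suc n) m"
  note defs = defs D_def D1_def E_def E1_def
  have 0: "(a - b * B) * D + A = (a - b * A) * E + B"
    using ratio_sum_swap[OF nz, of n m] by (simp add: defs)
  have 1: "(a - b * A) * D1 = (1 - p * A) * B * (1 + b * D)"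
    using ratio_sum_Suc_mult[OF nz, of m n] by (simp only: defs)
  have 2: "(a - b * B) * E1 = (1 - p * B) * A * (1 + b * E)"
    using ratio_sum_Suc_mult[OF nz, of n m] by (simp only: defs)
  have "(a - b * A) * (a - b * B) * (D1 - D) = (a - b * A) * (a - b * B) * (E1 - E)"
    using 0 1 2 by algebra
  then show ?thesis
    using nz[of m] nz[of n] by (simp add: defs)
qed

lemma dual_sum_eq_sum_ratio_sum:
  assumes p: "\<And>j. j \<ge> 1 \<Longrightarrow> p ^ j \<noteq> 1"
  shows "dual_sum p a b m n = (\<Sum>k<n. ratio_sum p a b m k)"
proof -
  have "(1 - p ^ (n * j)) / (1 - p ^ j) = (\<Sum>k<n. p ^ (k * j))" if "j \<ge> 1" for j
    using p[OF that] sum_gp_strict[of "p ^ j" n] by (simp add: power_mult[symmetric] mult.commute)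
  then have "dual_sum p a b m n =
      (\<Sum>j=1..m. \<Sum>k<n. b ^ (j - 1) * p ^ (k * j) * ratio_prod p a b m j)"
    unfolding dual_sum_def by (intro sum.cong) (auto simp: sum_distrib_left sum_distrib_right)
  then show ?thesis
    unfolding ratio_sum_def by (subst sum.swap)
qed

lemma dual_sum_commute:
  assumes nz: "\<And>i. a - b * p ^ i \<noteq> 0" and p: "\<And>j. j \<ge> 1 \<Longrightarrow> p ^ j \<noteq> 1"
  shows "dual_sum p a b m n = dual_sum p a b n m"
proof (induction m)
  case 0
  then show ?case by (simp add: dual_sum_eq_sum_ratio_sum[OF p])
next
  case (Suc m)
  \<comment> \<open>The swapped differences telescope, starting from an empty sum. So the increment
    of \<open>dual_sum p a b m n\<close> in \<open>m\<close> is that of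
    \<open>dual_sum p a b n m\<close> in \<open>m\<close>.\<close>
  have "(\<Sum>k<n. ratio_sum p a b (Suc m) k) = (\<Sum>k<n. ratio_sum p a b m k) + ratio_sum p a b n m"
  proof (induction n)
    case (Suc n)
    then show ?case using ratio_sum_diff_swap[OF nz, of m n] by simp
  qed simp
  then show ?case using Suc by (simp add: dual_sum_eq_sum_ratio_sum[OF p])
qed

section \<open>Symmetries of the q-Hahn rates\<close>

lemma has_sum_finite_sum:
  fixes f :: "'a \<Rightarrow> 'b \<Rightarrow> 'c :: topological_comm_monoid_add"
  assumes "finite F" "\<And>k. k \<in> F \<Longrightarrow> (f k has_sum S k) A"
  shows "((\<lambda>x. \<Sum>k\<in>F. f k x) has_sum (\<Sum>k\<in>F. S k)) A"
  using assms by (induction F rule: finite_induct) (auto intro!: has_sum_add has_sum_0)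

lemma qpoch_quotient:
  assumes "qpoch a q (m - j) \<noteq> 0" "j \<le> m"
  shows "qpoch a q m / qpoch a q (m - j) = (\<Prod>i=m-j..<m. 1 - a * q ^ i)"
proof -
  have "qpoch a q m = qpoch a q (m - j) * (\<Prod>i=m-j..<m. 1 - a * q ^ i)"
    unfolding qpoch_def lessThan_atLeast0
    by (rule prod.atLeastLessThan_concat[symmetric]) auto
  then show ?thesis using assms by simp
qed

context
  fixes q \<nu> :: real
  assumes q: "0 < q" "q < 1" and nu: "0 \<le> \<nu>" "\<nu> < 1"
begin

lemma power_q_neq_1: "j \<ge> 1 \<Longrightarrow> q ^ j \<noteq> 1"
  using q power_Suc_less_one[of q "j - 1"] by (auto simp: not_less)

lemma nu_power_less_1: "\<nu> * q ^ i < 1"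
  using q nu mult_left_le[of "q ^ i" \<nu>] power_le_one[of q i] by simp

lemma one_minus_nu_power_neq_0: "1 - \<nu> * q ^ i \<noteq> 0"
  using nu_power_less_1[of i] by simp

text \<open>Both sides are the limit of \<open>dual_sum q 1 \<nu> m n\<close> as \<open>n\<close>
  tends to infinity: taken termwise, and taken after exchanging the arguments.\<close>

lemma sum_ratio_prod_eq:
  "(\<Sum>j=1..m. \<nu> ^ (j - 1) / (1 - q ^ j) * ratio_prod q 1 \<nu> m j) =
    (\<Sum>k<m. q ^ k / (1 - \<nu> * q ^ k))"
proof (rule LIMSEQ_unique)
  have lim0: "(\<lambda>n. q ^ (n * j)) \<longlonglongrightarrow> 0" if "j \<ge> 1" for j
  proof -
    have "(\<lambda>n. (q ^ j) ^ n) \<longlonglongrightarrow> 0"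
      using q that power_q_neq_1[OF that] power_le_one[of q j] by (intro LIMSEQ_power_zero) auto
    then show ?thesis by (simp add: power_mult[symmetric] mult.commute)
  qed
  have D0: "(\<lambda>n. ratio_sum q 1 \<nu> m n) \<longlonglongrightarrow> 0" for m
    unfolding ratio_sum_def
    by (rule tendsto_null_sum, rule tendsto_mult_left_zero, rule tendsto_mult_right_zero)
       (auto intro: lim0)
  have "(\<lambda>n. dual_sum q 1 \<nu> m n) \<longlonglongrightarrow>
      (\<Sum>j=1..m. \<nu> ^ (j - 1) * ((1 - 0) / (1 - q ^ j)) * ratio_prod q 1 \<nu> m j)"
    unfolding dual_sum_def by (intro tendsto_intros lim0) (use power_q_neq_1 in auto)
  then show "(\<lambda>n. dual_sum q 1 \<nu> m n) \<longlonglongrightarrow>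
      (\<Sum>j=1..m. \<nu> ^ (j - 1) / (1 - q ^ j) * ratio_prod q 1 \<nu> m j)"
    by simp
  have "(\<lambda>n. ratio_sum q 1 \<nu> n k) \<longlonglongrightarrow> q ^ k / (1 - \<nu> * q ^ k)" for k
  proof -
    \<comment> \<open>The swap trades a growing number of summands for a sum of \<open>k\<close>
      terms, each tending to 0.\<close>
    have eq: "ratio_sum q 1 \<nu> n k =
        ((1 - \<nu> * q ^ n) * ratio_sum q 1 \<nu> k n + q ^ k - q ^ n) / (1 - \<nu> * q ^ k)" for n
      using ratio_sum_swap[OF one_minus_nu_power_neq_0, of k n] one_minus_nu_power_neq_0[of k] by (simp add: field_simps)
    have "(\<lambda>n. ((1 - \<nu> * q ^ n) * ratio_sum q 1 \<nu> k n + q ^ k - q ^ n) / (1 - \<nu> * q ^ k))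
        \<longlonglongrightarrow> ((1 - \<nu> * 0) * 0 + q ^ k - 0) / (1 - \<nu> * q ^ k)"
      using lim0[of 1] q by (intro tendsto_intros D0 one_minus_nu_power_neq_0) auto
    then show ?thesis unfolding eq by simp
  qed
  moreover have eq: "dual_sum q 1 \<nu> m n = (\<Sum>k<m. ratio_sum q 1 \<nu> n k)" for n
    using dual_sum_commute[OF one_minus_nu_power_neq_0 power_q_neq_1, of m n] dual_sum_eq_sum_ratio_sum[OF power_q_neq_1] by simp
  ultimately show "(\<lambda>n. dual_sum q 1 \<nu> m n) \<longlonglongrightarrow> (\<Sum>k<m. q ^ k / (1 - \<nu> * q ^ k))"
    unfolding eq by (intro tendsto_sum)
qed


lemma qpoch_quotient_eq_ratio_prod:
  assumes "j \<le> m"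
  shows "qpoch \<nu> q (m - j) / qpoch \<nu> q m * (qpoch q q m / qpoch q q (m - j)) =
    ratio_prod q 1 \<nu> m j"
proof -
  have nz: "qpoch \<nu> q n \<noteq> 0" "qpoch q q n \<noteq> 0" for n
    using q nu by (simp_all add: qpoch_nonzero)
  have "qpoch \<nu> q (m - j) / qpoch \<nu> q m * (qpoch q q m / qpoch q q (m - j)) =
      (qpoch q q m / qpoch q q (m - j)) / (qpoch \<nu> q m / qpoch \<nu> q (m - j))"
      using nz by (simp add: mult_ac)
  also have "\<dots> = ratio_prod q 1 \<nu> m j"
    unfolding qpoch_quotient[OF nz(1) assms] qpoch_quotient[OF nz(2) assms] ratio_prod_def
    by (simp add: prod_dividef)
  finally show ?thesis .
qed

lemma phiR_eq_ratio_prod: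
  assumes "j \<le> m"
  shows "phiR q \<nu> R j m = R * (1 - q) * (\<nu> ^ (j - 1) / (1 - q ^ j) * ratio_prod q 1 \<nu> m j)"
  unfolding phiR_def qnum_def qpoch_quotient_eq_ratio_prod[OF assms, symmetric] by (simp add: mult_ac)

text \<open>Replacing \<open>q\<close> by \<open>1 / q\<close> multiplies each of the
  \<open>j\<close> factors by \<open>1 / q\<close>, which \<open>q ^ j\<close> compensates. With
  \<open>b = 1\<close> the powers of \<open>\<nu>\<close> in the right rate disappear.\<close>

lemma phiL_eq_ratio_prod:
  assumes "j \<le> m"
  shows "phiL q \<nu> L j m =
    L * (1 - q) * (q ^ j / (1 - q ^ j) * ratio_prod (1 / q) \<nu> 1 m j)"
proof -
  have "(1 - (1 / q) ^ Suc i) / (\<nu> - 1 * (1 / q) ^ i) =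
      (1 / q) * ((1 - q ^ Suc i) / (1 - \<nu> * q ^ i))" for i
  proof -
    have "\<nu> * q ^ i \<noteq> 1"
      using nu_power_less_1[of i] by simp
    moreover from this have "\<nu> - (1 / q) ^ i \<noteq> 0"
      using q by (auto simp: field_simps)
    ultimately show ?thesis
      using q by (simp add: divide_simps) algebra
  qed
  then have "ratio_prod (1 / q) \<nu> 1 m j =
      (\<Prod>i=m-j..<m. (1 / q) * ((1 - q ^ Suc i) / (1 - \<nu> * q ^ i)))"
    unfolding ratio_prod_def by (intro prod.cong refl)
  also have "\<dots> = (1 / q) ^ j * ratio_prod q 1 \<nu> m j"
    unfolding ratio_prod_def prod.distrib using assms by simp
  finally have "q ^ j * ratio_prod (1 / q) \<nu> 1 m j = ratio_prod q 1 \<nu> m j"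
    using q by (simp add: power_one_over)
  then show ?thesis
    unfolding phiL_def qnum_def qpoch_quotient_eq_ratio_prod[OF assms, symmetric]
    by (simp add: mult.assoc)
qed

lemma sum_phiR_eq_dual_sum:
  "(\<Sum>j=1..m. phiR q \<nu> R j m * (h * q ^ (n * j) - h)) = - h * R * (1 - q) * dual_sum q 1 \<nu> m n"
  unfolding dual_sum_def sum_distrib_left
  by (intro sum.cong) (simp_all add: phiR_eq_ratio_prod field_simps)

lemma sum_phiL_eq_dual_sum:
  "(\<Sum>j=1..m. phiL q \<nu> L j m * (h * (1 / q) ^ (n * j) - h)) =
    h * L * (1 - q) * dual_sum (1 / q) \<nu> 1 m n"
  unfolding dual_sum_def sum_distrib_left
proof (intro sum.cong refl)
  fix j assume j: "j \<in> {1..m}"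
  define c where "c = (1 / q) ^ (n * j)"
  have nz: "q ^ j \<noteq> 0" "q ^ j \<noteq> 1" using q power_q_neq_1[of j] j by simp_all
  \<comment> \<open>\<open>q ^ j / (1 - q ^ j)\<close> equals
    \<open>- 1 / (1 - (1 / q) ^ j)\<close>, hence the sign opposite to that of the right
    jumps.\<close>
  have "q ^ j / (1 - q ^ j) * (c - 1) = (1 - c) / (1 - (1 / q) ^ j)"
    using nz q by (simp add: power_one_over field_simps)
  moreover have "phiL q \<nu> L j m * (h * c - h) =
      h * L * (1 - q) * (q ^ j / (1 - q ^ j) * (c - 1) * ratio_prod (1 / q) \<nu> 1 m j)"
    using j by (simp add: phiL_eq_ratio_prod algebra_simps)
  ultimately show "phiL q \<nu> L j m * (h * (1 / q) ^ (n * j) - h) = h * L * (1 - q) *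
      (1 ^ (j - 1) * ((1 - (1 / q) ^ (n * j)) / (1 - (1 / q) ^ j)) * ratio_prod (1 / q) \<nu> 1 m j)"
    by (simp add: c_def)
qed

lemma sum_phiR_commute:
  "(\<Sum>j=1..m. phiR q \<nu> R j m * (h * q ^ (n * j) - h)) =
   (\<Sum>j=1..n. phiR q \<nu> R j n * (h * q ^ (m * j) - h))"
  unfolding sum_phiR_eq_dual_sum
  by (subst dual_sum_commute[OF one_minus_nu_power_neq_0 power_q_neq_1]) simp_all

lemma sum_phiL_commute:
  "(\<Sum>j=1..m. phiL q \<nu> L j m * (h * (1 / q) ^ (n * j) - h)) =
   (\<Sum>j=1..n. phiL q \<nu> L j n * (h * (1 / q) ^ (m * j) - h))"
proof -
  have "\<nu> - 1 * (1 / q) ^ i \<noteq> 0" for i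
  proof -
    have "1 \<le> (1 / q) ^ i" using q by (intro one_le_power) simp
    then show ?thesis using nu by linarith
  qed
  moreover have "(1 / q) ^ j \<noteq> 1" if "j \<ge> 1" for j
    using q power_q_neq_1[OF that] by (simp add: power_one_over)
  ultimately show ?thesis
    unfolding sum_phiL_eq_dual_sum by (subst dual_sum_commute) auto
qed

text \<open>This is \<open>sum_phiR_commute\<close> for an infinite gap, where
  \<open>h * q ^ (n * j)\<close> becomes 0. Dividing \<open>1 - q ^ (m * j)\<close> by
  \<open>1 - q ^ j\<close> leaves \<open>m\<close> geometric series in \<open>j\<close>, whose total
  is given by \<open>sum_ratio_prod_eq\<close>.\<close>

lemma infsum_phiR_inf:
  "(\<Sum>\<^sub>\<infinity>j\<in>{1..}. phiR_inf q \<nu> R j * (h * q ^ (m * j) - h)) =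
   (\<Sum>j=1..m. phiR q \<nu> R j m * (0 - h))"
proof (rule infsumI)
  have geo: "((\<lambda>j. \<nu> ^ (j - 1) * q ^ (k * j)) has_sum q ^ k / (1 - \<nu> * q ^ k)) {1..}" for k
  proof -
    have "(\<lambda>n. q ^ k * (\<nu> * q ^ k) ^ n) sums (q ^ k * (1 / (1 - \<nu> * q ^ k)))"
      using q nu nu_power_less_1[of k] by (intro sums_mult geometric_sums) simp
    then have "((\<lambda>n. q ^ k * (\<nu> * q ^ k) ^ n) has_sum q ^ k / (1 - \<nu> * q ^ k)) UNIV"
      using q nu by (intro sums_nonneg_imp_has_sum) auto
    then show ?thesis
      by (rule iffD1[OF has_sum_reindex_bij_witness[where i = "\<lambda>j. j - 1" and j = Suc], rotated -1])
         (auto simp: power_add power_mult power_mult_distrib)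
  qed
  have "((\<lambda>j. - h * R * (1 - q) * (\<Sum>k<m. \<nu> ^ (j - 1) * q ^ (k * j))) has_sum
      - h * R * (1 - q) * (\<Sum>k<m. q ^ k / (1 - \<nu> * q ^ k))) {1..}"
    by (intro has_sum_cmult_right has_sum_finite_sum geo) simp
  also have "(\<Sum>k<m. q ^ k / (1 - \<nu> * q ^ k)) =
      (\<Sum>j=1..m. \<nu> ^ (j - 1) / (1 - q ^ j) * ratio_prod q 1 \<nu> m j)"
    by (rule sum_ratio_prod_eq[symmetric])
  also have "- h * R * (1 - q) * \<dots> = (\<Sum>j=1..m. phiR q \<nu> R j m * (0 - h))"
    unfolding sum_distrib_left by (intro sum.cong) (simp_all add: phiR_eq_ratio_prod)
  finally show "((\<lambda>j. phiR_inf q \<nu> R j * (h * q ^ (m * j) - h)) has_sum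
      (\<Sum>j=1..m. phiR q \<nu> R j m * (0 - h))) {1..}"
  proof (rule iffD1[OF has_sum_cong, rotated])
    fix j :: nat assume "j \<in> {1..}"
    then have nz: "q ^ j \<noteq> 1" using power_q_neq_1 by auto
    then have "(\<Sum>k<m. q ^ (k * j)) = (1 - q ^ (m * j)) / (1 - q ^ j)"
      using sum_gp_strict[of "q ^ j" m] by (simp add: power_mult[symmetric] mult.commute)
    then have sum_eq: "(\<Sum>k<m. \<nu> ^ (j - 1) * q ^ (k * j)) =
        \<nu> ^ (j - 1) * ((1 - q ^ (m * j)) / (1 - q ^ j))"
      by (simp only: sum_distrib_left[symmetric])
    show "- h * R * (1 - q) * (\<Sum>k<m. \<nu> ^ (j - 1) * q ^ (k * j)) =
        phiR_inf q \<nu> R j * (h * q ^ (m * j) - h)"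
      using q nu nz
      unfolding sum_eq by (simp add: phiR_inf_eq(2) qnum_def field_simps)
  qed
qed

end

section \<open>Effect of a single jump on the duality function\<close>

definition config :: "(nat \<Rightarrow> int) \<Rightarrow> nat \<Rightarrow> int extended" where
  "config X i = (if i = 0 then Pinf else Fin (X i))"

lemma X_infty_config:
  assumes "x \<in> X_infty"
  obtains X where "x = config X" "\<And>i. i \<ge> 1 \<Longrightarrow> X (Suc i) < X i"
proof -
  have x: "x 0 = Pinf" "\<And>i. i \<ge> 1 \<Longrightarrow> x i \<in> range Fin" "\<And>i. x (Suc i) < x i"
    using assms by (auto simp: X_infty_def)
  define X where "X i = (THE k. x i = Fin k)" for i
  have X: "x i = Fin (X i)" if "i \<ge> 1" for i
    using x(2)[OF that] by (auto simp: X_def)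
  show ?thesis
  proof
    show "x = config X" using x(1) X by (auto simp: config_def)
    show "X (Suc i) < X i" if "i \<ge> 1" for i
      using x(3)[of i] X[OF that] X[of "Suc i"] by simp
  qed
qed

lemma gap_config:
  assumes "i \<ge> 2"
  shows "gap (config X) i = nat (X (i - 1) - X i - 1)"
  using assms by (simp add: gap_def config_def one_extended_def)

lemma shift_config:
  "i \<ge> 1 \<Longrightarrow> shift (config X) i j = config (X(i := X i + j))"
  by (auto simp: shift_def config_def)

lemma move_in_Y_infty:
  assumes "y \<in> Y_infty"
  shows "move y i k j \<in> Y_infty"
proof -
  have "{l. move y i k j l \<noteq> 0} \<subseteq> {l. y l \<noteq> 0} \<union> {i, k}"
    by (auto simp: move_def)
  then show ?thesis
    using assms by (auto simp: Y_infty_finite_support intro: finite_subset)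
qed

text \<open>\<open>S\<close> may exceed the support, so that the states before and after a jump are
  compared over one index set. Site 0 is split off because its factor is 0 or 1, not a power of
  \<open>q\<close>.\<close>

lemma H_config:
  assumes "q \<noteq> 0" "finite S" "0 \<notin> S" "{i. y i \<noteq> 0} \<subseteq> insert 0 S"
  shows "H q (config X) y =
    (if y 0 = 0 then q powi (\<Sum>i\<in>S. (X i + int i) * int (y i)) else 0)"
proof -
  let ?f = "\<lambda>i. qpow q (config X i + Fin (int i)) (y i)"
  have f: "?f i = q powi ((X i + int i) * int (y i))" if "i \<noteq> 0" for i
    using that by (simp add: config_def qpow_def)
  have f0: "?f 0 = (if y 0 = 0 then 1 else 0)"
    by (simp add: config_def qpow_def)
  have "H q (config X) y = (\<Prod>i\<in>insert 0 S. ?f i)"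
    unfolding H_def
  proof (rule prodinf_finite)
    show "finite (insert 0 S)" using assms by simp
    show "?f i = 1" if "i \<notin> insert 0 S" for i
    proof -
      have "y i = 0" "i \<noteq> 0" using that assms by auto
      then show ?thesis using f[of i] by simp
    qed
  qed
  also have "\<dots> = ?f 0 * (\<Prod>i\<in>S. ?f i)"
    using assms by simp
  also have "(\<Prod>i\<in>S. ?f i) = (\<Prod>i\<in>S. q powi ((X i + int i) * int (y i)))"
    using assms(3) by (intro prod.cong refl f) metis
  also have "\<dots> = q powi (\<Sum>i\<in>S. (X i + int i) * int (y i))"
    using assms(2) by induction (use assms(1) in \<open>auto simp: power_int_add\<close>)
  finally show ?thesis unfolding f0 by simp
qed

lemma H_config_eq_0:
  assumes "y \<in> Y_infty" "y 0 > 0" "q \<noteq> 0"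
  shows "H q (config X) y = 0"
  using assms by (subst H_config[of _ "{i. y i \<noteq> 0} - {0}"]) (auto simp: Y_infty_finite_support)

lemma H_config_shift:
  assumes "y \<in> Y_infty" "q \<noteq> 0" "i \<ge> 1"
  shows "H q (config (X(i := X i + j))) y = H q (config X) y * q powi (j * int (y i))"
proof -
  define S where "S = insert i ({l. y l \<noteq> 0} - {0})"
  have S: "finite S" "0 \<notin> S" "{l. y l \<noteq> 0} \<subseteq> insert 0 S" "i \<in> S"
    using assms by (auto simp: S_def Y_infty_finite_support)
  have "(\<Sum>l\<in>S. ((X(i := X i + j)) l + int l) * int (y l)) =
      (\<Sum>l\<in>S. (X l + int l) * int (y l) + (if l = i then j * int (y i) else 0))"
    by (intro sum.cong) (auto simp: algebra_simps)
  also have "\<dots> = (\<Sum>l\<in>S. (X l + int l) * int (y l)) + j * int (y i)"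
    using S by (simp add: sum.distrib)
  finally show ?thesis
    using assms by (simp add: H_config[OF _ S(1-3)] power_int_add)
qed

lemma H_config_move:
  assumes "y \<in> Y_infty" "q \<noteq> 0" "i \<ge> 1" "k \<ge> 1" "i \<noteq> k" "j \<le> y i"
  shows "H q (config X) (move y i k j) =
    H q (config X) y * q powi ((X k + int k - (X i + int i)) * int j)"
proof -
  let ?y = "move y i k j"
  define S where "S = {i, k} \<union> ({l. y l \<noteq> 0} - {0})"
  have S: "finite S" "0 \<notin> S" "{l. y l \<noteq> 0} \<subseteq> insert 0 S" "{l. ?y l \<noteq> 0} \<subseteq> insert 0 S"
    "i \<in> S" "k \<in> S"
    using assms by (auto simp: S_def Y_infty_finite_support move_def)
  have "(\<Sum>l\<in>S. (X l + int l) * int (?y l)) =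
      (\<Sum>l\<in>S. (X l + int l) * int (y l) + (if l = k then (X k + int k) * int j else 0)
        - (if l = i then (X i + int i) * int j else 0))"
    using assms by (intro sum.cong) (auto simp: move_def of_nat_diff algebra_simps)
  also have "\<dots> = (\<Sum>l\<in>S. (X l + int l) * int (y l)) + (X k + int k - (X i + int i)) * int j"
    using S by (simp add: sum.distrib sum_subtractf left_diff_distrib)
  finally have *: "(\<Sum>l\<in>S. (X l + int l) * int (?y l)) =
      (\<Sum>l\<in>S. (X l + int l) * int (y l)) + (X k + int k - (X i + int i)) * int j" .
  have "?y 0 = y 0" using assms by (simp add: move_def)
  with * show ?thesis
    using assms by (simp add: H_config[OF _ S(1-3)] H_config[OF _ S(1,2,4)] power_int_add)
qed

section \<open>Termwise comparison of the two generators\<close>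

theorem proposition3p3:
  fixes q \<nu> R L :: real
    and x :: "nat \<Rightarrow> int extended"
    and y :: "nat \<Rightarrow> nat"
  assumes "0 < q" "q < 1"
    and "0 \<le> \<nu>" "\<nu> < 1"
    and "R \<ge> 0" "L \<ge> 0" "R + L = 1"
    and "x \<in> X_infty" "y \<in> Y_infty"
  shows "AZRP_gen q \<nu> R L (\<lambda>y'. H q x y') y = AEP_gen q \<nu> R L (\<lambda>x'. H q x' y) x"
proof -
  note q = assms(1,2) and nu = assms(3,4) and y = assms(9)
  have q0: "q \<noteq> 0" using q by simp
  obtain X where x: "x = config X" and X: "\<And>i. i \<ge> 1 \<Longrightarrow> X (Suc i) < X i"
    using X_infty_config[OF assms(8)] by blast
  show ?thesis
  proof (cases "y 0 = 0")
    case False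
    \<comment> \<open>No jump starts at site 0, so it stays occupied and every value of
      \<open>H\<close> in both generators is 0.\<close>
    have "H q x y = 0"
      using False y q0 by (simp add: x H_config_eq_0)
    moreover have "H q x (move y i k j) = 0" if "i \<ge> 1" for i k j
      unfolding x using that False y q0
      by (intro H_config_eq_0 move_in_Y_infty) (auto simp: move_def)
    moreover have "H q (shift x i j) y = 0" if "i \<ge> 1" for i j
      using that False y q0 by (simp add: x shift_config H_config_eq_0)
    ultimately show ?thesis
      unfolding AZRP_gen_def AEP_gen_def by (intro infsum_cong) auto
  next
    case True
    define h where "h = H q x y"
    define g where "g = gap x"
    have int_g: "int (g (Suc i)) = X i - X (Suc i) - 1" if "i \<ge> 1" for i
      using that X[OF that] by (simp add: g_def x gap_config)
    have move_left: "H q x (move y i (i - 1) j) = h * q ^ (g i * j)"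
      if "i \<ge> 2" "j \<le> y i" for i j
    proof -
      \<comment> \<open>The summand \<open>i\<close> in the exponent of \<open>H\<close> produces
        the \<open>- 1\<close> of the gap.\<close>
      have "(X (i - 1) + int (i - 1) - (X i + int i)) * int j = int (g i * j)"
        using that int_g[of "i - 1"] by (simp add: of_nat_diff)
      then show ?thesis
        using that y q0 H_config_move[of y q i "i - 1" j X]
        by (simp add: x h_def del: of_nat_mult)
    qed
    have move_right: "H q x (move y i (i + 1) j) = h * (1 / q) ^ (g (i + 1) * j)"
      if "i \<ge> 1" "j \<le> y i" for i j
    proof -
      have "(X (i + 1) + int (i + 1) - (X i + int i)) * int j = - int (g (i + 1) * j)"
        using that int_g[of i] by (simp flip: left_diff_distrib mult_minus_left)
      then show ?thesis
        using that y q0 H_config_move[of y q i "i + 1" j X]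
        by (simp add: x h_def power_int_minus power_one_over inverse_eq_divide del: of_nat_mult)
    qed
    have move_0: "H q x (move y (Suc 0) 0 j) = 0" if "j \<ge> 1" for j
      unfolding x using that y q0
      by (intro H_config_eq_0 move_in_Y_infty) (auto simp: move_def)
    have shift_right: "H q (shift x i (int j)) y = h * q ^ (y i * j)" if "i \<ge> 1" for i j
      using that y q0 H_config_shift[of y q i X "int j"]
      by (simp add: x h_def shift_config mult.commute flip: of_nat_mult)
    have shift_left: "H q (shift x i (- int j)) y = h * (1 / q) ^ (y i * j)" if "i \<ge> 1" for i j
      using that y q0 H_config_shift[of y q i X "- int j"]
      by (simp add: x h_def shift_config power_int_minus power_one_over inverse_eq_divide
          mult.commute flip: of_nat_mult)
    have "(\<Sum>j=1..y i. phiR q \<nu> R j (y i) * (H q x (move y i (i - 1) j) - h)) =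
        (if i = 1 then \<Sum>\<^sub>\<infinity>j\<in>{1..}. phiR_inf q \<nu> R j * (H q (shift x i (int j)) y - h)
         else \<Sum>j=1..g i. phiR q \<nu> R j (g i) * (H q (shift x i (int j)) y - h))"
      if i: "i \<ge> 1" for i
    proof (cases "i = 1")
      \<comment> \<open>Left jumps from site 1 land in site 0, where \<open>H\<close> vanishes;
        their counterpart is the infinite sum over the right jumps of the first particle.\<close>
      case True
      then show ?thesis
        using infsum_phiR_inf[OF q nu, of R h "y 1"] by (simp add: move_0 shift_right)
    next
      case False
      then show ?thesis
        using i sum_phiR_commute[OF q nu, of R "y i" h "g i"] move_left[of i]
        by (simp add: shift_right)
    qed
    moreover have "(\<Sum>j=1..y i. phiL q \<nu> L j (y i) * (H q x (move y i (i + 1) j) - h)) =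
        (\<Sum>j=1..g (i + 1). phiL q \<nu> L j (g (i + 1)) * (H q (shift x i (- int j)) y - h))"
      if "i \<ge> 1" for i
      using that sum_phiL_commute[OF q nu, of L "y i" h "g (i + 1)"] move_right[of i]
      by (simp add: shift_left)
    \<comment> \<open>The summands agree for each \<open>i\<close>, so the outer sums are equal
      without any convergence argument.\<close>
    ultimately show ?thesis
      unfolding AZRP_gen_def AEP_gen_def h_def[symmetric] g_def[symmetric]
      by (intro infsum_cong) simp
  qed
qed

end
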